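(* Let $S=\{u=u(x,y)\}$ be a surface of $\mathbb{R}^3$ with $u_{xx}u_{yy}-u_{xy}^2\neq 0$, and let $$\begin{aligned}F={}&6 u_{xx} u_{xxx} u_{xy} u_{yy}u_{yyy}-6 u_{xx} u_{xxx} u_{xyy}u_{yy}^2-18 u_{xx} u_{xxy} u_{xy}u_{xyy} u_{yy}+12 u_{xx} u_{xxy}u_{xy}^2 u_{yyy}\\&-6 u_{xx}^2 u_{xxy}u_{yy} u_{yyy}+9 u_{xx} u_{xxy}^2u_{yy}^2-6 u_{xx}^2 u_{xy} u_{xyy}u_{yyy}+9 u_{xx}^2 u_{xyy}^2u_{yy}+u_{xx}^3 u_{yyy}^2-6 u_{xxx}u_{xxy} u_{xy} u_{yy}^2\\&+12 u_{xxx}u_{xy}^2 u_{xyy} u_{yy}-8 u_{xxx}u_{xy}^3 u_{yyy}+u_{xxx}^2 u_{yy}^3.\end{aligned}$$ Then $F=0$ if and only if the Fubini–Pick invariant $C^{ijk}C_{ijk}$ of $S$ vanishes.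
   Context: Let $D$ be the Levi-Civita (flat) connection of $\mathbb{R}^3$ and $\omega$ a $D$-parallel volume form. For a surface $S\subset\mathbb{R}^3$ and a vector field $\xi$ along $S$ transversal to $S$, write $D_XY=\nabla^\xi_XY+h^\xi(X,Y)\xi$ for $X,Y$ tangent to $S$, with $\nabla^\xi_XY$ tangent to $S$; let $\omega^\xi(X,Y)=\omega(X,Y,\xi)$ and let $\tau^\xi$ be the $1$-form on $S$ with $\nabla^\xi\omega^\xi=\tau^\xi\otimes\omega^\xi$. $S$ is non-degenerate if $h^\xi$ has rank $2$ (independent of $\xi$). For non-degenerate $S$ there is a unique, up to sign, transversal field $\mathcal{A}$ (the affine normal) such that $\tau^{\mathcal{A}}=0$ and $\omega^{\mathcal{A}}$ coincides with the volume element of $h^{\mathcal{A}}$. Put $\nabla=\nabla^{\mathcal{A}}$ (Blaschke connection), $h=h^{\mathcal{A}}$ (Blaschke metric), and $C(X,Y,Z)=(\nabla_Xh)(Y,Z)$ (Fubini–Pick cubic form). The Fubini–Pick invariant is the function $C^{ijk}C_{ijk}=h^{i_1i_2}h^{j_1j_2}h^{k_1k_2}C_{i_1j_1k_1}C_{i_2j_2k_2}$, with $(h^{ij})$ the inverse of $(h_{ij})$. *)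

theory Defs
  imports "HOL-Analysis.Analysis"
begin

text \<open>
  A surface is given by a parametrization \<open>r\<close> on an open set \<open>U\<close> of parameters.  Tangent vector
  fields are represented by their components with respect to the coordinate frame, i.e. as maps
  \<open>real^2 \<Rightarrow> real^2\<close>; vector fields along the surface are maps \<open>real^2 \<Rightarrow> real^3\<close>.  All sets
  on which smoothness is required are meant to be open.
\<close>

primrec cont_diff_on ::
    "nat \<Rightarrow> 'a set \<Rightarrow> ('a::real_normed_vector \<Rightarrow> 'b::real_normed_vector) \<Rightarrow> bool" where
  "cont_diff_on 0 U f \<longleftrightarrow> continuous_on U f"
| "cont_diff_on (Suc k) U f \<longleftrightarrow>
     f differentiable_on U \<and> (\<forall>v. cont_diff_on k U (\<lambda>x. frechet_derivative f (at x) v))"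

definition smooth_on ::
    "'a set \<Rightarrow> ('a::real_normed_vector \<Rightarrow> 'b::real_normed_vector) \<Rightarrow> bool" where
  "smooth_on U f \<longleftrightarrow> (\<forall>k. cont_diff_on k U f)"

subsection \<open>Parallel volume forms on three-space\<close>

definition volume_form :: "(real^3 \<Rightarrow> real^3 \<Rightarrow> real^3 \<Rightarrow> real) \<Rightarrow> bool" where
  "volume_form \<alpha> \<longleftrightarrow>
     (\<forall>a b. linear (\<lambda>v. \<alpha> v a b) \<and> linear (\<lambda>v. \<alpha> a v b) \<and> linear (\<lambda>v. \<alpha> a b v)) \<and>
     (\<forall>a b. \<alpha> a a b = 0 \<and> \<alpha> a b a = 0 \<and> \<alpha> b a a = 0) \<and>
     (\<exists>a b c. \<alpha> a b c \<noteq> 0)"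

text \<open>
  The covariant derivative of a form with respect to the flat connection is tensorial, so it
  suffices to test parallelism on constant vector fields, whose own derivatives vanish.
\<close>

definition parallel_volume_form :: "(real^3 \<Rightarrow> real^3 \<Rightarrow> real^3 \<Rightarrow> real^3 \<Rightarrow> real) \<Rightarrow> bool" where
  "parallel_volume_form \<omega> \<longleftrightarrow>
     (\<forall>q. volume_form (\<omega> q)) \<and>
     (\<forall>q a b c. ((\<lambda>x. \<omega> x a b c) has_derivative (\<lambda>_. 0)) (at q))"

subsection \<open>Structures induced by a transversal field\<close>

definition push :: "(real^2 \<Rightarrow> real^3) \<Rightarrow> (real^2 \<Rightarrow> real^2) \<Rightarrow> real^2 \<Rightarrow> real^3" where
  "push r X p = frechet_derivative r (at p) (X p)"

text \<open>
  The derivative along \<open>X\<close> of a function or of a vector field along the surface; for the latter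
  this is the flat connection, \<open>D\<^sub>X V\<close>.
\<close>

definition deriv_along ::
    "(real^2 \<Rightarrow> real^2) \<Rightarrow> (real^2 \<Rightarrow> 'b::real_normed_vector) \<Rightarrow> real^2 \<Rightarrow> 'b" where
  "deriv_along X V p = frechet_derivative V (at p) (X p)"

definition transversal_on ::
    "(real^2) set \<Rightarrow> (real^2 \<Rightarrow> real^3) \<Rightarrow> (real^2 \<Rightarrow> real^3) \<Rightarrow> bool" where
  "transversal_on U r \<xi> \<longleftrightarrow> smooth_on U \<xi> \<and> (\<forall>p\<in>U. \<xi> p \<notin> range (frechet_derivative r (at p)))"

text \<open>
  The decomposition \<open>D\<^sub>X Y = \<nabla>\<^sub>X Y + h(X,Y) \<xi>\<close>, as the pair of \<open>\<nabla>\<^sub>X Y\<close> and \<open>h(X,Y)\<close>.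
\<close>

definition gauss_decomp ::
    "(real^2 \<Rightarrow> real^3) \<Rightarrow> (real^2 \<Rightarrow> real^3) \<Rightarrow> (real^2 \<Rightarrow> real^2) \<Rightarrow> (real^2 \<Rightarrow> real^2) \<Rightarrow>
      real^2 \<Rightarrow> (real^2) \<times> real" where
  "gauss_decomp r \<xi> X Y p =
     (THE (w, c). deriv_along X (push r Y) p = frechet_derivative r (at p) w + c *\<^sub>R \<xi> p)"

definition induced_conn ::
    "(real^2 \<Rightarrow> real^3) \<Rightarrow> (real^2 \<Rightarrow> real^3) \<Rightarrow> (real^2 \<Rightarrow> real^2) \<Rightarrow> (real^2 \<Rightarrow> real^2) \<Rightarrow>
      real^2 \<Rightarrow> real^2" where
  "induced_conn r \<xi> X Y p = fst (gauss_decomp r \<xi> X Y p)"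

definition affine_form ::
    "(real^2 \<Rightarrow> real^3) \<Rightarrow> (real^2 \<Rightarrow> real^3) \<Rightarrow> (real^2 \<Rightarrow> real^2) \<Rightarrow> (real^2 \<Rightarrow> real^2) \<Rightarrow>
      real^2 \<Rightarrow> real" where
  "affine_form r \<xi> X Y p = snd (gauss_decomp r \<xi> X Y p)"

definition induced_area ::
    "(real^3 \<Rightarrow> real^3 \<Rightarrow> real^3 \<Rightarrow> real^3 \<Rightarrow> real) \<Rightarrow> (real^2 \<Rightarrow> real^3) \<Rightarrow> (real^2 \<Rightarrow> real^3) \<Rightarrow>
      (real^2 \<Rightarrow> real^2) \<Rightarrow> (real^2 \<Rightarrow> real^2) \<Rightarrow> real^2 \<Rightarrow> real" where
  "induced_area \<omega> r \<xi> X Y p = \<omega> (r p) (push r X p) (push r Y p) (\<xi> p)"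

text \<open>The covariant derivative \<open>(\<nabla>\<^sub>X B)(Y,Z)\<close> of a covariant 2-tensor \<open>B\<close>.\<close>

definition cov_deriv2 ::
    "((real^2 \<Rightarrow> real^2) \<Rightarrow> (real^2 \<Rightarrow> real^2) \<Rightarrow> real^2 \<Rightarrow> real^2) \<Rightarrow>
     ((real^2 \<Rightarrow> real^2) \<Rightarrow> (real^2 \<Rightarrow> real^2) \<Rightarrow> real^2 \<Rightarrow> real) \<Rightarrow>
      (real^2 \<Rightarrow> real^2) \<Rightarrow> (real^2 \<Rightarrow> real^2) \<Rightarrow> (real^2 \<Rightarrow> real^2) \<Rightarrow> real^2 \<Rightarrow> real" where
  "cov_deriv2 nab B X Y Z p =
     deriv_along X (B Y Z) p - B (nab X Y) Z p - B Y (nab X Z) p"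

text \<open>
  \<open>\<tau>\<close> is the 1-form with \<open>\<nabla>\<^sup>\<xi> \<omega>\<^sup>\<xi> = \<tau> \<otimes> \<omega>\<^sup>\<xi>\<close>; it is unique on \<open>U\<close> because \<open>\<omega>\<^sup>\<xi>\<close> vanishes nowhere.
\<close>

definition transversal_conn_form ::
    "(real^3 \<Rightarrow> real^3 \<Rightarrow> real^3 \<Rightarrow> real^3 \<Rightarrow> real) \<Rightarrow> (real^2) set \<Rightarrow> (real^2 \<Rightarrow> real^3) \<Rightarrow>
      (real^2 \<Rightarrow> real^3) \<Rightarrow> (real^2 \<Rightarrow> real^2 \<Rightarrow> real) \<Rightarrow> bool" where
  "transversal_conn_form \<omega> U r \<xi> \<tau> \<longleftrightarrow>
     (\<forall>p\<in>U. linear (\<tau> p)) \<and>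
     (\<forall>X Y Z. smooth_on U X \<longrightarrow> smooth_on U Y \<longrightarrow> smooth_on U Z \<longrightarrow>
       (\<forall>p\<in>U. cov_deriv2 (induced_conn r \<xi>) (induced_area \<omega> r \<xi>) X Y Z p =
                \<tau> p (X p) * induced_area \<omega> r \<xi> Y Z p))"

text \<open>
  \<open>\<omega>\<^sup>\<xi>\<close> is the volume element of the metric \<open>h\<^sup>\<xi>\<close>, for the orientation of the surface determined by
  \<open>\<omega>\<^sup>\<xi>\<close> itself; no other orientation is given, and replacing \<open>\<xi>\<close> by \<open>-\<xi>\<close> reverses this one.
  The absolute value accounts for indefinite metrics.
\<close>

definition area_is_volume_element ::
    "(real^3 \<Rightarrow> real^3 \<Rightarrow> real^3 \<Rightarrow> real^3 \<Rightarrow> real) \<Rightarrow> (real^2) set \<Rightarrow> (real^2 \<Rightarrow> real^3) \<Rightarrow>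
      (real^2 \<Rightarrow> real^3) \<Rightarrow> bool" where
  "area_is_volume_element \<omega> U r \<xi> \<longleftrightarrow>
     (\<forall>X Y. smooth_on U X \<longrightarrow> smooth_on U Y \<longrightarrow>
       (\<forall>p\<in>U. induced_area \<omega> r \<xi> X Y p > 0 \<longrightarrow>
          induced_area \<omega> r \<xi> X Y p =
            sqrt \<bar>affine_form r \<xi> X X p * affine_form r \<xi> Y Y p
                   - affine_form r \<xi> X Y p * affine_form r \<xi> Y X p\<bar>))"

definition affine_normal ::
    "(real^3 \<Rightarrow> real^3 \<Rightarrow> real^3 \<Rightarrow> real^3 \<Rightarrow> real) \<Rightarrow> (real^2) set \<Rightarrow> (real^2 \<Rightarrow> real^3) \<Rightarrow>
      (real^2 \<Rightarrow> real^3) \<Rightarrow> bool" where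
  "affine_normal \<omega> U r A \<longleftrightarrow>
     transversal_on U r A \<and>
     transversal_conn_form \<omega> U r A (\<lambda>p v. 0) \<and>
     area_is_volume_element \<omega> U r A"

subsection \<open>The Fubini--Pick invariant\<close>

text \<open>
  The argument \<open>A\<close> below is meant to be an affine normal, so that \<open>affine_form r A\<close> is the Blaschke
  metric and \<open>induced_conn r A\<close> the Blaschke connection.
\<close>

definition cubic_form ::
    "(real^2 \<Rightarrow> real^3) \<Rightarrow> (real^2 \<Rightarrow> real^3) \<Rightarrow>
      (real^2 \<Rightarrow> real^2) \<Rightarrow> (real^2 \<Rightarrow> real^2) \<Rightarrow> (real^2 \<Rightarrow> real^2) \<Rightarrow> real^2 \<Rightarrow> real" where
  "cubic_form r A = cov_deriv2 (induced_conn r A) (affine_form r A)"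

definition coord_field :: "2 \<Rightarrow> real^2 \<Rightarrow> real^2" where
  "coord_field i = (\<lambda>_. axis i 1)"

definition metric_matrix :: "(real^2 \<Rightarrow> real^3) \<Rightarrow> (real^2 \<Rightarrow> real^3) \<Rightarrow> real^2 \<Rightarrow> real^2^2" where
  "metric_matrix r A p = (\<chi> i j. affine_form r A (coord_field i) (coord_field j) p)"

definition fubini_pick :: "(real^2 \<Rightarrow> real^3) \<Rightarrow> (real^2 \<Rightarrow> real^3) \<Rightarrow> real^2 \<Rightarrow> real" where
  "fubini_pick r A p =
     (let g = matrix_inv (metric_matrix r A p);
          C = (\<lambda>i j k. cubic_form r A (coord_field i) (coord_field j) (coord_field k) p)
      in \<Sum>i1\<in>UNIV. \<Sum>j1\<in>UNIV. \<Sum>k1\<in>UNIV. \<Sum>i2\<in>UNIV. \<Sum>j2\<in>UNIV. \<Sum>k2\<in>UNIV.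
           g $ i1 $ i2 * g $ j1 $ j2 * g $ k1 $ k2 * C i1 j1 k1 * C i2 j2 k2)"

subsection \<open>Graphs\<close>

definition graph_param :: "(real^2 \<Rightarrow> real) \<Rightarrow> real^2 \<Rightarrow> real^3" where
  "graph_param u p = vector [p $ 1, p $ 2, u p]"

definition pd :: "2 \<Rightarrow> (real^2 \<Rightarrow> real) \<Rightarrow> real^2 \<Rightarrow> real" where
  "pd i f p = frechet_derivative f (at p) (axis i 1)"

definition hessian_det :: "(real^2 \<Rightarrow> real) \<Rightarrow> real^2 \<Rightarrow> real" where
  "hessian_det u p = pd 1 (pd 1 u) p * pd 2 (pd 2 u) p - (pd 2 (pd 1 u) p)\<^sup>2"

definition pick_F :: "(real^2 \<Rightarrow> real) \<Rightarrow> real^2 \<Rightarrow> real" where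
  "pick_F u p =
     (let uxx = pd 1 (pd 1 u) p; uxy = pd 2 (pd 1 u) p; uyy = pd 2 (pd 2 u) p;
          uxxx = pd 1 (pd 1 (pd 1 u)) p; uxxy = pd 2 (pd 1 (pd 1 u)) p;
          uxyy = pd 2 (pd 2 (pd 1 u)) p; uyyy = pd 2 (pd 2 (pd 2 u)) p
      in 6 * uxx * uxxx * uxy * uyy * uyyy - 6 * uxx * uxxx * uxyy * uyy^2
         - 18 * uxx * uxxy * uxy * uxyy * uyy + 12 * uxx * uxxy * uxy^2 * uyyy
         - 6 * uxx^2 * uxxy * uyy * uyyy + 9 * uxx * uxxy^2 * uyy^2
         - 6 * uxx^2 * uxy * uxyy * uyyy + 9 * uxx^2 * uxyy^2 * uyy + uxx^3 * uyyy^2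
         - 6 * uxxx * uxxy * uxy * uyy^2 + 12 * uxxx * uxy^2 * uxyy * uyy
         - 8 * uxxx * uxy^3 * uyyy + uxxx^2 * uyy^3)"

end

theory Submission
  imports Defs
begin

text \<open>
  Write the affine normal of the graph as \<open>A = r\<^sub>* a + t e\<^sub>3\<close>, with \<open>a\<close> tangent.  Then
  \<open>h\<^sub>i\<^sub>j = u\<^sub>i\<^sub>j / t\<close> and \<open>\<nabla>\<^sub>i \<partial>\<^sub>j = - h\<^sub>i\<^sub>j a\<close>.  The condition \<open>\<tau> = 0\<close> reads
  \<open>\<partial>\<^sub>k t = - u\<^sub>k\<^sub>l a\<^sup>l\<close>, and the volume condition makes \<open>t\<^sup>4 / \<bar>H\<bar>\<close> constant, where \<open>H\<close> is the
  Hessian determinant, so that \<open>s\<^sub>k = \<partial>\<^sub>k t / t = \<partial>\<^sub>k H / (4 H)\<close>.  Hence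
  \<open>t C\<^sub>i\<^sub>j\<^sub>k = u\<^sub>i\<^sub>j\<^sub>k - s\<^sub>i u\<^sub>j\<^sub>k - s\<^sub>j u\<^sub>i\<^sub>k - s\<^sub>k u\<^sub>i\<^sub>j\<close>, which is the trace-free part of the third
  derivative of \<open>u\<close> with respect to its Hessian.  The polynomial \<open>F\<close> is four times the squared norm of
  this trace-free part with respect to the adjugate of the Hessian, and the Fubini-Pick invariant is
  \<open>t F / (4 H\<^sup>3)\<close>.
\<close>

section \<open>Smooth functions, partial derivatives and their symmetry\<close>

lemma cont_diff_on_const: "cont_diff_on k U (\<lambda>_. c)"
  by (induction k arbitrary: c) (simp_all add: differentiable_on_def)

lemma smooth_on_coord_field: "smooth_on U (coord_field i)"
  by (simp add: smooth_on_def coord_field_def cont_diff_on_const)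

lemma smooth_on_imp_differentiable:
  assumes "smooth_on U f" "open U" "p \<in> U"
  shows "f differentiable (at p)"
proof -
  have "cont_diff_on (Suc 0) U f" using assms(1) smooth_on_def by blast
  then show ?thesis using assms(2,3)
    by (simp add: differentiable_on_eq_differentiable_at)
qed

lemma smooth_on_pd:
  assumes "smooth_on U f" shows "smooth_on U (pd i f)"
proof -
  have "cont_diff_on k U (pd i f)" for k
  proof -
    have "cont_diff_on (Suc k) U f" using assms smooth_on_def by blast
    then show ?thesis by (simp add: pd_def[abs_def])
  qed
  then show ?thesis by (simp add: smooth_on_def)
qed

lemma pd_eq: "(f has_derivative f') (at p) \<Longrightarrow> pd i f p = f' (axis i 1)"
  unfolding pd_def by (metis frechet_derivative_at)

lemma pd_cong:
  assumes "f differentiable (at p)" "open U" "p \<in> U" "\<And>q. q \<in> U \<Longrightarrow> f q = g q"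
  shows "pd i f p = pd i g p"
  unfolding pd_def using frechet_derivative_transform_within_open[OF assms] by simp

lemma has_derivative_pd:
  assumes "f differentiable (at p)"
  shows "(f has_derivative (\<lambda>v. v $ 1 * pd 1 f p + v $ 2 * pd 2 f p)) (at p)"
proof -
  let ?L = "frechet_derivative f (at p)"
  have d: "(f has_derivative ?L) (at p)" using assms by (simp add: frechet_derivative_works[symmetric])
  interpret L: linear ?L using assms by (rule linear_frechet_derivative)
  have "?L v = v $ 1 * pd 1 f p + v $ 2 * pd 2 f p" for v
  proof -
    have "v = v $ 1 *\<^sub>R axis 1 1 + v $ 2 *\<^sub>R axis 2 1"
      by (simp add: vec_eq_iff forall_2 axis_def)
    then have "?L v = ?L (v $ 1 *\<^sub>R axis 1 1 + v $ 2 *\<^sub>R axis 2 1)" by simp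
    then show ?thesis by (simp add: L.add L.scaleR pd_def)
  qed
  then have "?L = (\<lambda>v. v $ 1 * pd 1 f p + v $ 2 * pd 2 f p)" by blast
  then show ?thesis using d by simp
qed

lemma has_derivative_vec_nth_iff:
  fixes f :: "'a::real_normed_vector \<Rightarrow> real^'n"
  shows "(f has_derivative f') (at p) \<longleftrightarrow>
    (\<forall>i. ((\<lambda>x. f x $ i) has_derivative (\<lambda>v. f' v $ i)) (at p))"
  by (subst has_derivative_componentwise_within)
    (auto simp: Basis_vec_def inner_axis)

lemma differentiable_vec_nth:
  fixes f :: "'a::real_normed_vector \<Rightarrow> real^'n"
  assumes "\<forall>i. (\<lambda>x. f x $ i) differentiable (at p)"
  shows "f differentiable (at p)"
proof -
  obtain D where "\<And>i. ((\<lambda>x. f x $ i) has_derivative D i) (at p)"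
    using assms unfolding differentiable_def by metis
  then have "(f has_derivative (\<lambda>v. \<chi> i. D i v)) (at p)"
    by (simp add: has_derivative_vec_nth_iff)
  then show ?thesis unfolding differentiable_def by blast
qed

text \<open>The second difference along \<open>v\<close> and \<open>w\<close> is symmetric in \<open>v\<close> and \<open>w\<close>, so its limit gives
  the symmetry of the second derivative.\<close>

lemma second_difference_tendsto:
  fixes f :: "'a::real_normed_vector \<Rightarrow> real" and v w :: 'a
  defines "G \<equiv> \<lambda>x. frechet_derivative f (at x) v"
  assumes "open U" "p \<in> U" and f: "\<And>q. q \<in> U \<Longrightarrow> f differentiable (at q)"
    and G: "G differentiable (at p)"
  shows "((\<lambda>s. (f (p + s *\<^sub>R v + s *\<^sub>R w) - f (p + s *\<^sub>R v) - f (p + s *\<^sub>R w) + f p) / s\<^sup>2)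
    \<longlongrightarrow> frechet_derivative G (at p) w) (at_right 0)"
proof (rule tendstoI)
  fix e :: real assume e: "e > 0"
  let ?L = "frechet_derivative G (at p)"
  define N where "N = norm v + norm w + 1"
  have N: "N > 0" by (simp add: N_def add_nonneg_pos)
  have GL: "(G has_derivative ?L) (at p)" using G by (simp add: frechet_derivative_works[symmetric])
  interpret L: bounded_linear ?L using GL by (rule has_derivative_bounded_linear)
  \<comment> \<open>Chosen so that two errors of size \<open>e' * (s * N)\<close> add up to
    \<open>s * (e / 2)\<close>.\<close>
  define e' where "e' = e / (4 * N)"
  have e': "e' > 0" using e N by (simp add: e'_def)
  obtain d where d: "d > 0"
    and dG: "\<And>y. norm (y - p) < d \<Longrightarrow> norm (G y - G p - ?L (y - p)) \<le> e' * norm (y - p)"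
    using GL e' unfolding has_derivative_at_alt by blast
  obtain d' where d': "d' > 0" "ball p d' \<subseteq> U" using assms(2,3) openE by blast
  \<comment> \<open>For \<open>s < s0\<close> the parallelogram at \<open>p\<close> with sides
    \<open>s\<close> times \<open>v\<close> and \<open>w\<close> lies in \<open>U\<close> and in the
    ball where \<open>dG\<close> applies.\<close>
  define s0 where "s0 = min d d' / N"
  have s0: "s0 > 0" using d d' N by (simp add: s0_def)
  have main: "dist ((f (p + s *\<^sub>R v + s *\<^sub>R w) - f (p + s *\<^sub>R v) - f (p + s *\<^sub>R w) + f p) / s\<^sup>2) (?L w) < e"
    if s: "0 < s" "s < s0" for s
  proof -
    have sN: "s * N < d" "s * N < d'"
      using s N by (simp_all add: s0_def pos_less_divide_eq)
    have near: "norm (z *\<^sub>R v + c *\<^sub>R w) \<le> s * N" if "0 \<le> z" "z \<le> s" "0 \<le> c" "c \<le> s" for z c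
    proof -
      have "norm (z *\<^sub>R v + c *\<^sub>R w) \<le> z * norm v + c * norm w"
        using norm_triangle_ineq[of "z *\<^sub>R v" "c *\<^sub>R w"] that by simp
      also have "\<dots> \<le> s * norm v + s * norm w"
        using that by (intro add_mono mult_right_mono) auto
      also have "\<dots> \<le> s * N" using s by (simp add: N_def algebra_simps)
      finally show ?thesis .
    qed
    have inU: "p + z *\<^sub>R v + c *\<^sub>R w \<in> U" if "0 \<le> z" "z \<le> s" "0 \<le> c" "c \<le> s" for z c
    proof -
      have "dist p (p + z *\<^sub>R v + c *\<^sub>R w) < d'"
        using near[OF that] sN norm_minus_cancel[of "z *\<^sub>R v + c *\<^sub>R w"] by (simp add: dist_norm add.assoc del: add_uminus_conv_diff)
      then show ?thesis using d' by auto
    qed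
    have dfz: "((\<lambda>z. f (p + z *\<^sub>R v + c *\<^sub>R w)) has_real_derivative G (p + z *\<^sub>R v + c *\<^sub>R w)) (at z)"
      if "0 \<le> z" "z \<le> s" "0 \<le> c" "c \<le> s" for z c
    proof -
      let ?q = "p + z *\<^sub>R v + c *\<^sub>R w"
      have df: "(f has_derivative frechet_derivative f (at ?q)) (at ?q)"
        using f[OF inU[OF that]] by (simp add: frechet_derivative_works[symmetric])
      interpret D: bounded_linear "frechet_derivative f (at ?q)"
        using df by (rule has_derivative_bounded_linear)
      have "((\<lambda>z. p + z *\<^sub>R v + c *\<^sub>R w) has_derivative (\<lambda>h. h *\<^sub>R v)) (at z)"
        by (auto intro!: derivative_eq_intros)
      from has_derivative_compose[OF this df]
      have "((\<lambda>z. f (p + z *\<^sub>R v + c *\<^sub>R w)) has_derivative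
          (\<lambda>h. frechet_derivative f (at ?q) (h *\<^sub>R v))) (at z)" .
      moreover have "(\<lambda>h. frechet_derivative f (at ?q) (h *\<^sub>R v)) = (*) (G ?q)"
        by (simp add: fun_eq_iff D.scaleR G_def)
      ultimately show ?thesis by (simp only: has_field_derivative_def)
    qed
    \<comment> \<open>Mean value theorem for the difference of \<open>f\<close> along the two sides
      parallel to \<open>v\<close>. The terms with factor 0 keep both summands in the form covered
      by \<open>dfz\<close>.\<close>
    have "\<exists>z. 0 < z \<and> z < s \<and>
      (f (p + s *\<^sub>R v + s *\<^sub>R w) - f (p + s *\<^sub>R v + 0 *\<^sub>R w)) - (f (p + 0 *\<^sub>R v + s *\<^sub>R w) - f (p + 0 *\<^sub>R v + 0 *\<^sub>R w))
      = (s - 0) * (G (p + z *\<^sub>R v + s *\<^sub>R w) - G (p + z *\<^sub>R v + 0 *\<^sub>R w))"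
      by (rule MVT2[OF s(1)], intro DERIV_diff dfz) (use s in auto)
    then obtain z where z: "0 < z" "z < s" and
      S: "f (p + s *\<^sub>R v + s *\<^sub>R w) - f (p + s *\<^sub>R v) - f (p + s *\<^sub>R w) + f p
       = s * (G (p + z *\<^sub>R v + s *\<^sub>R w) - G (p + z *\<^sub>R v))"
      by (auto simp: algebra_simps)
    have bound: "norm (G (p + y) - G p - ?L y) \<le> e' * (s * N)" if "norm y \<le> s * N" for y
    proof -
      have "norm (G (p + y) - G p - ?L y) \<le> e' * norm y"
        using dG[of "p + y"] that sN by simp
      also have "\<dots> \<le> e' * (s * N)" using that e' by (intro mult_left_mono) auto
      finally show ?thesis .
    qed
    \<comment> \<open>Both values of \<open>G\<close> are compared with its linearization at
      \<open>p\<close>, the one point where \<open>G\<close> is assumed differentiable; in the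
      difference \<open>G p\<close> and the \<open>v\<close> terms cancel.\<close>
    have b1: "norm (G (p + z *\<^sub>R v + s *\<^sub>R w) - G p - ?L (z *\<^sub>R v + s *\<^sub>R w)) \<le> e' * (s * N)"
      using bound[OF near[of z s]] z s by (simp add: add.assoc)
    have b2: "norm (G (p + z *\<^sub>R v) - G p - ?L (z *\<^sub>R v)) \<le> e' * (s * N)"
      using bound[OF near[of z 0]] z s by simp
    have "\<bar>(G (p + z *\<^sub>R v + s *\<^sub>R w) - G (p + z *\<^sub>R v)) - s * ?L w\<bar> \<le> 2 * (e' * (s * N))"
      using b1 b2 by (simp add: L.add L.scaleR)
    also have "\<dots> = s * (e / 2)" using N by (simp add: e'_def field_simps)
    finally have "\<bar>(G (p + z *\<^sub>R v + s *\<^sub>R w) - G (p + z *\<^sub>R v)) - s * ?L w\<bar> \<le> s * (e / 2)" .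
    moreover have "(G (p + z *\<^sub>R v + s *\<^sub>R w) - G (p + z *\<^sub>R v)) / s - ?L w
        = ((G (p + z *\<^sub>R v + s *\<^sub>R w) - G (p + z *\<^sub>R v)) - s * ?L w) / s"
      using s by (simp add: field_simps)
    ultimately have "\<bar>(G (p + z *\<^sub>R v + s *\<^sub>R w) - G (p + z *\<^sub>R v)) / s - ?L w\<bar> \<le> e / 2"
      using s by (simp add: abs_divide divide_le_eq mult.commute)
    then show ?thesis unfolding S using s e by (simp add: dist_real_def power2_eq_square)
  qed
  show "\<forall>\<^sub>F s in at_right 0. dist ((f (p + s *\<^sub>R v + s *\<^sub>R w) - f (p + s *\<^sub>R v) - f (p + s *\<^sub>R w) + f p) / s\<^sup>2) (?L w) < e"
    unfolding eventually_at_right_field using s0 main by blast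
qed

lemma pd_commute:
  assumes "open U" "p \<in> U" "smooth_on U f"
  shows "pd i (pd j f) p = pd j (pd i f) p"
proof -
  let ?S = "\<lambda>i j s. (f (p + s *\<^sub>R axis j 1 + s *\<^sub>R axis i 1) - f (p + s *\<^sub>R axis j 1) - f (p + s *\<^sub>R axis i 1) + f p) / s\<^sup>2"
  have lim: "(?S i j \<longlongrightarrow> pd i (pd j f) p) (at_right 0)" for i j
  proof -
    have pd: "pd j f = (\<lambda>x. frechet_derivative f (at x) (axis j 1))"
      by (simp add: pd_def fun_eq_iff)
    have "pd j f differentiable (at p)"
      by (rule smooth_on_imp_differentiable[OF smooth_on_pd[OF assms(3)] assms(1,2)])
    then show ?thesis
      using second_difference_tendsto[OF assms(1,2) smooth_on_imp_differentiable[OF assms(3,1)],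
          of "axis j 1" "axis i 1"]
      unfolding pd_def[of i] unfolding pd by simp
  qed
  have "?S i j = ?S j i" by (simp add: fun_eq_iff add.commute add.left_commute)
  with lim[of i j] have "(?S i j \<longlongrightarrow> pd j (pd i f) p) (at_right 0)" by simp
  then show ?thesis by (rule tendsto_unique[OF trivial_limit_at_right_real lim])
qed

section \<open>Volume forms as multiples of the determinant\<close>

text \<open>Multilinearity expands each argument in the standard basis; alternation removes the
  terms with a repeated basis vector, and the six remaining signed terms are the Leibniz
  formula.\<close>

lemma volume_form_expand:
  assumes "volume_form \<alpha>"
  shows "\<alpha> x y z = \<alpha> (axis 1 1) (axis 2 1) (axis 3 1) * det (vector [x, y, z] :: real^3^3)"
proof -
  have l1: "linear (\<lambda>v. \<alpha> v a b)" and l2: "linear (\<lambda>v. \<alpha> a v b)" and l3: "linear (\<lambda>v. \<alpha> a b v)"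
    and alt: "\<alpha> a a b = 0" "\<alpha> a b a = 0" "\<alpha> b a a = 0" for a b
    using assms by (auto simp: volume_form_def)
  note lin = linear_add[OF l1] linear_add[OF l2] linear_add[OF l3]
    linear_cmul[OF l1] linear_cmul[OF l2] linear_cmul[OF l3]
  \<comment> \<open>Polarization: the form vanishes when \<open>a + b\<close> is inserted
    twice.\<close>
  have s12: "\<alpha> a b c = - \<alpha> b a c" for a b c
    using alt(1)[of "a + b" c] unfolding lin unfolding alt by linarith
  have s23: "\<alpha> a b c = - \<alpha> a c b" for a b c
    using alt(3)[of a "b + c"] unfolding lin unfolding alt by linarith
  let ?e = "\<lambda>i::3. axis i (1::real)"
  have perm: "\<alpha> (?e 2) (?e 1) (?e 3) = - \<alpha> (?e 1) (?e 2) (?e 3)"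
    "\<alpha> (?e 1) (?e 3) (?e 2) = - \<alpha> (?e 1) (?e 2) (?e 3)"
    "\<alpha> (?e 2) (?e 3) (?e 1) = \<alpha> (?e 1) (?e 2) (?e 3)"
    "\<alpha> (?e 3) (?e 1) (?e 2) = \<alpha> (?e 1) (?e 2) (?e 3)"
    "\<alpha> (?e 3) (?e 2) (?e 1) = - \<alpha> (?e 1) (?e 2) (?e 3)"
    using s12[of "?e 2" "?e 1" "?e 3"] s23[of "?e 1" "?e 3" "?e 2"] s23[of "?e 2" "?e 3" "?e 1"]
      s12[of "?e 3" "?e 1" "?e 2"] s12[of "?e 3" "?e 2" "?e 1"] by linarith+
  have b: "v = v$1 *\<^sub>R ?e 1 + v$2 *\<^sub>R ?e 2 + v$3 *\<^sub>R ?e 3" for v :: "real^3"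
    by (simp add: vec_eq_iff forall_3 axis_def)
  have "\<alpha> x y z = \<alpha> (x$1 *\<^sub>R ?e 1 + x$2 *\<^sub>R ?e 2 + x$3 *\<^sub>R ?e 3)
     (y$1 *\<^sub>R ?e 1 + y$2 *\<^sub>R ?e 2 + y$3 *\<^sub>R ?e 3) (z$1 *\<^sub>R ?e 1 + z$2 *\<^sub>R ?e 2 + z$3 *\<^sub>R ?e 3)"
    by (subst (1) b[of x], subst (1) b[of y], subst (1) b[of z]) (rule refl)
  also have "\<dots> = \<alpha> (axis 1 1) (axis 2 1) (axis 3 1) * det (vector [x, y, z] :: real^3^3)"
    unfolding lin alt perm real_scaleR_def det_3 vector_3 by (simp add: algebra_simps)
  finally show ?thesis .
qed

text \<open>The coefficients have zero derivative on the whole space, so the form is the same at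
  every base point; the factor is nonzero because a volume form is not identically zero.\<close>

lemma parallel_volume_form_det:
  assumes "parallel_volume_form \<omega>"
  obtains \<kappa> where "\<kappa> \<noteq> 0"
    "\<And>q x y z. \<omega> q x y z = \<kappa> * det (vector [x, y, z] :: real^3^3)"
proof -
  have vf: "volume_form (\<omega> q)" for q using assms by (simp add: parallel_volume_form_def)
  have const: "\<omega> q x y z = \<omega> 0 x y z" for q x y z
  proof -
    have "((\<lambda>q. \<omega> q x y z) has_derivative (\<lambda>_. 0)) (at q within UNIV)" for q
      using assms by (simp add: parallel_volume_form_def)
    then obtain c where "\<And>q. \<omega> q x y z = c"
      using has_derivative_zero_constant[of UNIV "\<lambda>q. \<omega> q x y z"] by auto
    then show ?thesis by simp
  qed
  let ?k = "\<omega> 0 (axis 1 1) (axis 2 1) (axis 3 1)"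
  have "?k \<noteq> 0"
    using volume_form_expand[OF vf[of 0]] vf[of 0] unfolding volume_form_def by (metis mult_zero_left)
  moreover have "\<omega> q x y z = ?k * det (vector [x, y, z] :: real^3^3)" for q x y z
    using const[of q x y z] volume_form_expand[OF vf[of 0]] by metis
  ultimately show ?thesis using that by blast
qed

section \<open>Binary cubic forms and their norm\<close>

text \<open>The polynomial F in free variables: \<open>p, q, r\<close> replace the second and
  \<open>a, b, c, d\<close> the third derivatives, so that it can also be evaluated at the
  trace-free part.\<close>

definition pick_poly :: "real \<Rightarrow> real \<Rightarrow> real \<Rightarrow> real \<Rightarrow> real \<Rightarrow> real \<Rightarrow> real \<Rightarrow> real" where
  "pick_poly p q r a b c d =
     6 * p * a * q * r * d - 6 * p * a * c * r^2 - 18 * p * b * q * c * r + 12 * p * b * q^2 * d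
     - 6 * p^2 * b * r * d + 9 * p * b^2 * r^2 - 6 * p^2 * q * c * d + 9 * p^2 * c^2 * r
     + p^3 * d^2 - 6 * a * b * q * r^2 + 12 * a * q^2 * c * r - 8 * a * q^3 * d + a^2 * r^3"

lemma pick_F_eq_pick_poly:
  "pick_F u p = pick_poly (pd 1 (pd 1 u) p) (pd 2 (pd 1 u) p) (pd 2 (pd 2 u) p)
     (pd 1 (pd 1 (pd 1 u)) p) (pd 2 (pd 1 (pd 1 u)) p)
     (pd 2 (pd 2 (pd 1 u)) p) (pd 2 (pd 2 (pd 2 u)) p)"
  by (simp add: pick_F_def pick_poly_def Let_def mult_ac)

text \<open>
  Indices are contracted with the adjugate of the symmetric matrix \<open>[[p, q], [q, r]]\<close>, which makes
  this a polynomial; \<open>a, b, c, d\<close> are the components \<open>111, 112, 122, 222\<close> of the cubic form.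
\<close>

definition cubic_norm :: "real \<Rightarrow> real \<Rightarrow> real \<Rightarrow> real \<Rightarrow> real \<Rightarrow> real \<Rightarrow> real \<Rightarrow> real" where
  "cubic_norm p q r a b c d =
     r^3 * a^2 + p^3 * d^2 + 3 * p * r^2 * b^2 + 6 * q^2 * r * b^2 + 3 * p^2 * r * c^2
     + 6 * p * q^2 * c^2 - 6 * q * r^2 * a * b + 6 * q^2 * r * a * c - 2 * q^3 * a * d
     - 6 * q^3 * b * c - 12 * p * q * r * b * c + 6 * p * q^2 * b * d - 6 * p^2 * q * c * d"

text \<open>The hypotheses say that the cubic form is trace-free for the adjugate
  \<open>[[r, -q], [-q, p]]\<close>. In general the two sides differ by three times the adjugate
  square of the trace covector \<open>(?A, ?B)\<close>.\<close>

lemma apolar_cubic_norm: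
  assumes "r * a - 2 * q * b + p * c = 0" "r * b - 2 * q * c + p * d = 0"
  shows "4 * cubic_norm p q r a b c d = pick_poly p q r a b c d"
proof -
  let ?A = "r * a - 2 * q * b + p * c" and ?B = "r * b - 2 * q * c + p * d"
  have "4 * cubic_norm p q r a b c d
      = pick_poly p q r a b c d + 3 * (r * ?A^2 - 2 * q * ?A * ?B + p * ?B^2)"
    unfolding cubic_norm_def pick_poly_def by algebra
  then show ?thesis unfolding assms by simp
qed

text \<open>\<open>pick_poly\<close> only depends on the trace-free part of the cubic form.\<close>

lemma pick_poly_shift:
  "pick_poly p q r (a - 3 * s1 * p) (b - 2 * s1 * q - s2 * p) (c - 2 * s2 * q - s1 * r) (d - 3 * s2 * r)
    = pick_poly p q r a b c d"
  unfolding pick_poly_def by algebra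

lemma matrix_inv_unique:
  fixes M N :: "'a::semiring_1^'n^'n"
  assumes "M ** N = mat 1" "N ** M = mat 1"
  shows "matrix_inv M = N"
proof -
  have "M ** matrix_inv M = mat 1 \<and> matrix_inv M ** M = mat 1"
    unfolding matrix_inv_def by (rule someI[of _ N]) (use assms in simp)
  then have "matrix_inv M = (N ** M) ** matrix_inv M" "M ** matrix_inv M = mat 1"
    using assms by simp_all
  then show ?thesis by (metis matrix_mul_assoc matrix_mul_rid)
qed

section \<open>Derivatives of the graph parametrization\<close>

text \<open>This is the affine fundamental form of the graph for the constant vertical field
  \<open>axis 3 1\<close>; see \<open>deriv_along_push\<close>.\<close>

definition hess :: "(real^2 \<Rightarrow> real) \<Rightarrow> real^2 \<Rightarrow> real^2 \<Rightarrow> real^2 \<Rightarrow> real" where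
  "hess u p v w = (\<Sum>i\<in>UNIV. \<Sum>j\<in>UNIV. pd i (pd j u) p * v $ i * w $ j)"

lemma graph_param_has_derivative:
  assumes "u differentiable (at p)"
  shows "(graph_param u has_derivative
    (\<lambda>v. vector [v $ 1, v $ 2, v $ 1 * pd 1 u p + v $ 2 * pd 2 u p])) (at p)"
  unfolding has_derivative_vec_nth_iff forall_3 graph_param_def
  using has_derivative_pd[OF assms]
  by (auto intro: bounded_linear_imp_has_derivative bounded_linear_vec_nth)

lemma frechet_derivative_graph_param:
  assumes "u differentiable (at p)"
  shows "frechet_derivative (graph_param u) (at p) v =
    vector [v $ 1, v $ 2, v $ 1 * pd 1 u p + v $ 2 * pd 2 u p]"
  by (rule fun_cong[OF frechet_derivative_at[OF graph_param_has_derivative[OF assms]], symmetric])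

lemma hess_axis: "hess u p (axis i 1) (axis j 1) = pd i (pd j u) p"
  using exhaust_2[of i] exhaust_2[of j] by (auto simp: hess_def sum_2 axis_def)

lemma hess_scale:
  "hess u p (c *\<^sub>R v) w = c * hess u p v w" "hess u p v (c *\<^sub>R w) = c * hess u p v w"
  by (simp_all add: hess_def sum_2 algebra_simps)

lemma coord_field_differentiable: "coord_field i differentiable (at p)"
  by (simp add: coord_field_def)

lemma deriv_along_coord: "deriv_along (coord_field i) f p = pd i f p"
  by (simp add: deriv_along_def coord_field_def pd_def)

section \<open>Gauss decomposition and cubic form of a transversal field along a graph\<close>

locale transversal_graph =
  fixes U :: "(real^2) set" and u :: "real^2 \<Rightarrow> real" and A :: "real^2 \<Rightarrow> real^3"
  assumes U: "open U" and u: "smooth_on U u" and A: "transversal_on U (graph_param u) A"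
begin

text \<open>\<open>A = (graph_param u)\<^sub>* a + t e\<^sub>3\<close> with \<open>t = height\<close> and \<open>a = horizontal\<close>.\<close>

definition height :: "real^2 \<Rightarrow> real" where
  "height p = A p $ 3 - A p $ 1 * pd 1 u p - A p $ 2 * pd 2 u p"

definition horizontal :: "real^2 \<Rightarrow> real^2" where
  "horizontal p = vector [A p $ 1, A p $ 2]"

lemma u_differentiable: "p \<in> U \<Longrightarrow> u differentiable (at p)"
  using smooth_on_imp_differentiable[OF u U] .

lemma pd_differentiable: "p \<in> U \<Longrightarrow> pd i u differentiable (at p)"
  using smooth_on_imp_differentiable[OF smooth_on_pd[OF u] U] .

lemma pd2_differentiable: "p \<in> U \<Longrightarrow> pd i (pd j u) differentiable (at p)"
  using smooth_on_imp_differentiable[OF smooth_on_pd[OF smooth_on_pd[OF u]] U] .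

lemma A_differentiable: "p \<in> U \<Longrightarrow> (\<lambda>q. A q $ i) differentiable (at p)"
proof -
  assume p: "p \<in> U"
  have "A differentiable (at p)"
    using smooth_on_imp_differentiable[OF _ U p] A by (auto simp: transversal_on_def)
  then obtain A' where "(A has_derivative A') (at p)" by (auto simp: differentiable_def)
  then show ?thesis unfolding has_derivative_vec_nth_iff differentiable_def by blast
qed

lemma height_differentiable: "p \<in> U \<Longrightarrow> height differentiable (at p)"
  unfolding height_def[abs_def]
  by (intro differentiable_diff differentiable_mult A_differentiable pd_differentiable)

lemma push_eq:
  assumes "p \<in> U"
  shows "push (graph_param u) Y p = vector [Y p $ 1, Y p $ 2, Y p $ 1 * pd 1 u p + Y p $ 2 * pd 2 u p]"
  unfolding push_def by (rule frechet_derivative_graph_param[OF u_differentiable[OF assms]])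

lemma A_eq:
  assumes "p \<in> U"
  shows "A p = frechet_derivative (graph_param u) (at p) (horizontal p) + height p *\<^sub>R axis 3 1"
  unfolding frechet_derivative_graph_param[OF u_differentiable[OF assms]] vec_eq_iff forall_3
  by (simp add: height_def horizontal_def axis_def algebra_simps)

lemma height_nonzero:
  assumes "p \<in> U" shows "height p \<noteq> 0"
proof
  assume "height p = 0"
  then have "A p = frechet_derivative (graph_param u) (at p) (horizontal p)"
    using A_eq[OF assms] by simp
  then show False using A assms by (auto simp: transversal_on_def)
qed

text \<open>The product rule in the third component of \<open>push_eq\<close> gives terms with
  derivatives of \<open>Y\<close>, which complete a tangent vector, and Hessian terms, which are
  vertical.\<close>

lemma deriv_along_push:
  assumes p: "p \<in> U" and Y: "Y differentiable (at p)"
  shows "deriv_along X (push (graph_param u) Y) p =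
    frechet_derivative (graph_param u) (at p) (frechet_derivative Y (at p) (X p))
      + hess u p (X p) (Y p) *\<^sub>R axis 3 1"
proof -
  let ?Y = "frechet_derivative Y (at p)"
  have Y': "((\<lambda>q. Y q $ i) has_derivative (\<lambda>v. ?Y v $ i)) (at p)" for i
    using Y has_derivative_vec_nth_iff frechet_derivative_works by blast
  have "((\<lambda>q. vector [Y q $ 1, Y q $ 2, Y q $ 1 * pd 1 u q + Y q $ 2 * pd 2 u q] :: real^3)
    has_derivative (\<lambda>v. vector [?Y v $ 1, ?Y v $ 2,
      Y p $ 1 * (v $ 1 * pd 1 (pd 1 u) p + v $ 2 * pd 2 (pd 1 u) p) + ?Y v $ 1 * pd 1 u p
      + (Y p $ 2 * (v $ 1 * pd 1 (pd 2 u) p + v $ 2 * pd 2 (pd 2 u) p) + ?Y v $ 2 * pd 2 u p)])) (at p)"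
    unfolding has_derivative_vec_nth_iff forall_3 vector_3
    by (intro conjI Y' has_derivative_add has_derivative_mult has_derivative_pd pd_differentiable p)
  then have "(push (graph_param u) Y has_derivative (\<lambda>v. vector [?Y v $ 1, ?Y v $ 2,
      Y p $ 1 * (v $ 1 * pd 1 (pd 1 u) p + v $ 2 * pd 2 (pd 1 u) p) + ?Y v $ 1 * pd 1 u p
      + (Y p $ 2 * (v $ 1 * pd 1 (pd 2 u) p + v $ 2 * pd 2 (pd 2 u) p) + ?Y v $ 2 * pd 2 u p)])) (at p)"
    by (rule has_derivative_transform_within_open[OF _ U p]) (simp add: push_eq)
  note deriv = fun_cong[OF frechet_derivative_at[OF this], of "X p", symmetric]
  show ?thesis
    unfolding deriv_along_def deriv frechet_derivative_graph_param[OF u_differentiable[OF p]]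
    by (simp only: vec_eq_iff forall_3 hess_def sum_2) (simp add: axis_def algebra_simps)
qed

text \<open>By \<open>A_eq\<close>, the vertical vector is \<open>A\<close> minus the pushed-forward
  \<open>horizontal p\<close>, divided by \<open>height p\<close>. Inserting this in
  \<open>deriv_along_push\<close> gives the decomposition.\<close>

lemma gauss_decomp_eq:
  assumes p: "p \<in> U" and Y: "Y differentiable (at p)"
  shows "gauss_decomp (graph_param u) A X Y p =
    (frechet_derivative Y (at p) (X p) - (hess u p (X p) (Y p) / height p) *\<^sub>R horizontal p,
     hess u p (X p) (Y p) / height p)"
proof -
  let ?D = "frechet_derivative (graph_param u) (at p)"
  interpret D: linear ?D
    using graph_param_has_derivative[OF u_differentiable[OF p]]
    by (intro linear_frechet_derivative) (auto simp: differentiable_def)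
  note t = height_nonzero[OF p]
  let ?k = "hess u p (X p) (Y p)" and ?Y = "frechet_derivative Y (at p) (X p)"
  have D_nth: "?D v $ 1 = v $ 1" "?D v $ 2 = v $ 2" "?D v $ 3 = v $ 1 * pd 1 u p + v $ 2 * pd 2 u p" for v
    by (simp_all add: frechet_derivative_graph_param[OF u_differentiable[OF p]])
  have uniq: "w = ?Y - (?k / height p) *\<^sub>R horizontal p \<and> c = ?k / height p"
    if eq: "?D ?Y + ?k *\<^sub>R axis 3 1 = ?D w + c *\<^sub>R (?D (horizontal p) + height p *\<^sub>R axis 3 1)" for w c
  proof -
    have eq1: "?Y $ 1 = w $ 1 + c * horizontal p $ 1"
      using arg_cong[OF eq, of "\<lambda>v. v $ 1"] by (simp add: D_nth axis_def)
    have eq2: "?Y $ 2 = w $ 2 + c * horizontal p $ 2"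
      using arg_cong[OF eq, of "\<lambda>v. v $ 2"] by (simp add: D_nth axis_def)
    \<comment> \<open>With the first two components inserted, the slope terms cancel in the third
      and only the heights remain.\<close>
    have "?k = c * height p"
      using arg_cong[OF eq, of "\<lambda>v. v $ 3"] by (simp add: D_nth axis_def eq1 eq2 algebra_simps)
    then have "c = ?k / height p" using t by simp
    then show ?thesis using eq1 eq2 by (simp add: vec_eq_iff forall_2)
  qed
  have ex: "?D ?Y + ?k *\<^sub>R axis 3 1 = ?D (?Y - (?k / height p) *\<^sub>R horizontal p)
      + (?k / height p) *\<^sub>R (?D (horizontal p) + height p *\<^sub>R axis 3 1)"
    using t by (simp add: D.diff D.scaleR algebra_simps)
  show ?thesis
    unfolding gauss_decomp_def deriv_along_push[OF assms] A_eq[OF p]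
  proof (rule the_equality, goal_cases)
    case 1
    show ?case using ex by simp
  next
    case (2 x)
    then show ?case using uniq[of "fst x" "snd x"] by (simp add: prod_eq_iff split_beta)
  qed
qed

lemma affine_form_eq:
  assumes "p \<in> U" and "Y differentiable (at p)"
  shows "affine_form (graph_param u) A X Y p = hess u p (X p) (Y p) / height p"
  by (simp add: affine_form_def gauss_decomp_eq[OF assms])

lemma induced_conn_eq:
  assumes "p \<in> U" and "Y differentiable (at p)"
  shows "induced_conn (graph_param u) A X Y p =
    frechet_derivative Y (at p) (X p) - (hess u p (X p) (Y p) / height p) *\<^sub>R horizontal p"
  by (simp add: induced_conn_def gauss_decomp_eq[OF assms])

lemma affine_form_coord:
  assumes "p \<in> U"
  shows "affine_form (graph_param u) A (coord_field i) (coord_field j) p = pd i (pd j u) p / height p"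
  using affine_form_eq[OF assms coord_field_differentiable] by (simp add: coord_field_def hess_axis)

lemma induced_conn_coord:
  assumes "p \<in> U"
  shows "induced_conn (graph_param u) A (coord_field i) (coord_field j) p =
    - (pd i (pd j u) p / height p) *\<^sub>R horizontal p"
  using induced_conn_eq[OF assms coord_field_differentiable] by (simp add: coord_field_def hess_axis)

text \<open>In the cubic form the covariant derivative of a coordinate field becomes the second
  argument of \<open>affine_form\<close>, which \<open>affine_form_eq\<close> requires to be
  differentiable.\<close>

lemma induced_conn_coord_differentiable:
  assumes "p \<in> U"
  shows "induced_conn (graph_param u) A (coord_field i) (coord_field j) differentiable (at p)"
proof -
  have "(\<lambda>q. - (pd i (pd j u) q / height q) * A q $ k) differentiable (at p)" for k
    by (intro differentiable_mult differentiable_minus differentiable_divide A_differentiable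
        pd2_differentiable height_differentiable height_nonzero assms)
  then have "(\<lambda>q. - (pd i (pd j u) q / height q) *\<^sub>R horizontal q) differentiable (at p)"
    by (intro differentiable_vec_nth) (auto simp: forall_2 horizontal_def)
  then obtain D where
    "((\<lambda>q. - (pd i (pd j u) q / height q) *\<^sub>R horizontal q) has_derivative D) (at p)"
    by (auto simp: differentiable_def)
  then have "(induced_conn (graph_param u) A (coord_field i) (coord_field j) has_derivative D) (at p)"
    by (rule has_derivative_transform_within_open[OF _ U assms]) (simp add: induced_conn_coord)
  then show ?thesis by (auto simp: differentiable_def)
qed

lemma hess_axis_horizontal:
  "hess u p (axis i 1) (horizontal p) = pd i (pd 1 u) p * A p $ 1 + pd i (pd 2 u) p * A p $ 2"
  using exhaust_2[of i] by (auto simp: hess_def sum_2 axis_def horizontal_def)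

lemma hess_horizontal_axis:
  "hess u p (horizontal p) (axis j 1) = pd 1 (pd j u) p * A p $ 1 + pd 2 (pd j u) p * A p $ 2"
  using exhaust_2[of j] by (auto simp: hess_def sum_2 axis_def horizontal_def)

lemma pd_affine_form_coord:
  assumes p: "p \<in> U"
  shows "pd k (affine_form (graph_param u) A (coord_field i) (coord_field j)) p =
    pd k (pd i (pd j u)) p / height p - pd i (pd j u) p * pd k height p / (height p)\<^sup>2"
proof -
  note t = height_nonzero[OF p]
  have "((\<lambda>q. pd i (pd j u) q / height q) has_derivative
      (\<lambda>v. - pd i (pd j u) p * (inverse (height p) * (v $ 1 * pd 1 height p + v $ 2 * pd 2 height p) * inverse (height p))
        + (v $ 1 * pd 1 (pd i (pd j u)) p + v $ 2 * pd 2 (pd i (pd j u)) p) / height p)) (at p)"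
    by (intro has_derivative_divide has_derivative_pd pd2_differentiable height_differentiable t p)
  then have "(affine_form (graph_param u) A (coord_field i) (coord_field j) has_derivative
      (\<lambda>v. - pd i (pd j u) p * (inverse (height p) * (v $ 1 * pd 1 height p + v $ 2 * pd 2 height p) * inverse (height p))
        + (v $ 1 * pd 1 (pd i (pd j u)) p + v $ 2 * pd 2 (pd i (pd j u)) p) / height p)) (at p)"
    by (rule has_derivative_transform_within_open[OF _ U p]) (simp add: affine_form_coord)
  note pd = pd_eq[OF this, of k]
  show ?thesis
    unfolding pd using exhaust_2[of k] t by (auto simp: axis_def field_simps power2_eq_square)
qed

text \<open>The first two terms are the quotient rule for the metric coefficients. Since \<nabla> of
  coordinate fields is a multiple of \<open>horizontal\<close>, each connection term is a product of
  a second derivative of \<open>u\<close> and a contraction of the Hessian with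
  \<open>horizontal\<close>.\<close>

lemma cubic_form_coord:
  assumes p: "p \<in> U"
  shows "cubic_form (graph_param u) A (coord_field k) (coord_field i) (coord_field j) p =
    (pd k (pd i (pd j u)) p - pd i (pd j u) p * pd k height p / height p
     + pd k (pd i u) p * (pd 1 (pd j u) p * A p $ 1 + pd 2 (pd j u) p * A p $ 2) / height p
     + pd k (pd j u) p * (pd i (pd 1 u) p * A p $ 1 + pd i (pd 2 u) p * A p $ 2) / height p) / height p"
proof -
  note t = height_nonzero[OF p]
  let ?c = "\<lambda>i. coord_field i" and ?h = "affine_form (graph_param u) A"
  let ?n = "induced_conn (graph_param u) A"
  have 1: "?h (?n (?c k) (?c i)) (?c j) p =
      - (pd k (pd i u) p / height p) * (pd 1 (pd j u) p * A p $ 1 + pd 2 (pd j u) p * A p $ 2) / height p"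
    unfolding affine_form_eq[OF p coord_field_differentiable] induced_conn_coord[OF p] hess_scale
    by (simp add: coord_field_def hess_horizontal_axis)
  have 2: "?h (?c i) (?n (?c k) (?c j)) p =
      - (pd k (pd j u) p / height p) * (pd i (pd 1 u) p * A p $ 1 + pd i (pd 2 u) p * A p $ 2) / height p"
    unfolding affine_form_eq[OF p induced_conn_coord_differentiable[OF p]] induced_conn_coord[OF p] hess_scale
    by (simp add: coord_field_def hess_axis_horizontal)
  show ?thesis
    unfolding cubic_form_def cov_deriv2_def deriv_along_coord pd_affine_form_coord[OF p] 1 2
    using t by (simp add: field_simps power2_eq_square)
qed

end

section \<open>The affine normal, apolarity and the Fubini-Pick invariant\<close>

locale blaschke_graph = transversal_graph +
  fixes \<kappa> :: real and \<omega> :: "real^3 \<Rightarrow> real^3 \<Rightarrow> real^3 \<Rightarrow> real^3 \<Rightarrow> real"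
  assumes kappa: "\<kappa> \<noteq> 0"
    and \<omega>_eq: "\<And>q x y z. \<omega> q x y z = \<kappa> * det (vector [x, y, z] :: real^3^3)"
    and normal: "affine_normal \<omega> U (graph_param u) A"
    and hessian: "\<And>p. p \<in> U \<Longrightarrow> hessian_det u p \<noteq> 0"
begin

text \<open>The tangential part of \<open>A\<close> drops out of the determinant.\<close>

lemma induced_area_eq:
  assumes "p \<in> U"
  shows "induced_area \<omega> (graph_param u) A X Y p =
    \<kappa> * height p * (X p $ 1 * Y p $ 2 - X p $ 2 * Y p $ 1)"
  unfolding induced_area_def \<omega>_eq det_3 vector_3 push_eq[OF assms] height_def
  by (simp add: algebra_simps)

text \<open>The area of the coordinate frame is \<open>\<kappa> * height p\<close>, and its two
  connection terms combine to the trace of \<nabla> along the k-th coordinate field; \<tau> = 0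
  balances this trace against the derivative of the height.\<close>

lemma pd_height:
  assumes p: "p \<in> U"
  shows "pd k height p = - (pd k (pd 1 u) p * A p $ 1 + pd k (pd 2 u) p * A p $ 2)"
proof -
  note t = height_nonzero[OF p]
  let ?w = "induced_area \<omega> (graph_param u) A" and ?n = "induced_conn (graph_param u) A"
  have "((\<lambda>q. \<kappa> * height q) has_derivative (\<lambda>v. \<kappa> * (v $ 1 * pd 1 height p + v $ 2 * pd 2 height p))) (at p)"
    by (intro has_derivative_mult_right has_derivative_pd height_differentiable p)
  then have "(?w (coord_field 1) (coord_field 2) has_derivative
      (\<lambda>v. \<kappa> * (v $ 1 * pd 1 height p + v $ 2 * pd 2 height p))) (at p)"
    by (rule has_derivative_transform_within_open[OF _ U p])
      (simp add: induced_area_eq coord_field_def axis_def)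
  from pd_eq[OF this, of k]
  have 1: "pd k (?w (coord_field 1) (coord_field 2)) p = \<kappa> * pd k height p"
    using exhaust_2[of k] by (auto simp: axis_def)
  have "cov_deriv2 ?n ?w (coord_field k) (coord_field 1) (coord_field 2) p = 0"
    using normal p smooth_on_coord_field unfolding affine_normal_def transversal_conn_form_def by simp
  then have "\<kappa> * pd k height p = \<kappa> * - (pd k (pd 1 u) p * A p $ 1 + pd k (pd 2 u) p * A p $ 2)"
    unfolding cov_deriv2_def deriv_along_coord 1 induced_area_eq[OF p] induced_conn_coord[OF p]
    using t by (simp add: coord_field_def axis_def horizontal_def field_simps)
  then show ?thesis unfolding mult_left_cancel[OF kappa] .
qed

text \<open>Squared once more than necessary, so that the sign of the Hessian determinant plays no role.\<close>

lemma height_hessian: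
  assumes p: "p \<in> U"
  shows "\<kappa>^4 * height p ^ 8 = (hessian_det u p)\<^sup>2"
proof -
  let ?w = "induced_area \<omega> (graph_param u) A" and ?h = "affine_form (graph_param u) A"
  let ?c = "\<lambda>i. coord_field i"
  note t = height_nonzero[OF p]
  have vol: "?w X Y p = sqrt \<bar>?h X X p * ?h Y Y p - ?h X Y p * ?h Y X p\<bar>"
    if "?w X Y p > 0" "smooth_on U X" "smooth_on U Y" for X Y
    using normal p that unfolding affine_normal_def area_is_volume_element_def by blast
  let ?d = "\<bar>hessian_det u p / (height p)\<^sup>2\<bar>"
  have d: "\<bar>?h (?c i) (?c i) p * ?h (?c j) (?c j) p - ?h (?c i) (?c j) p * ?h (?c j) (?c i) p\<bar> = ?d"
    if "(i = 1 \<and> j = 2) \<or> (i = 2 \<and> j = 1)" for i j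
    using that pd_commute[OF U p u, of 1 2] unfolding affine_form_coord[OF p] hessian_det_def
    by (auto simp: power2_eq_square diff_divide_distrib mult.commute)
  have w: "?w (?c 1) (?c 2) p = \<kappa> * height p" "?w (?c 2) (?c 1) p = - (\<kappa> * height p)"
    by (simp_all add: induced_area_eq[OF p] coord_field_def axis_def)
  have "\<bar>\<kappa> * height p\<bar> = sqrt ?d"
  \<comment> \<open>The volume condition speaks only of frames of positive area, so for negative
    \<open>\<kappa> * height p\<close> the coordinate fields are taken in reverse order.\<close>
  proof (cases "\<kappa> * height p > 0")
    case True
    then show ?thesis
      using vol[of "?c 1" "?c 2"] d[of 1 2] by (simp add: w smooth_on_coord_field)
  next
    case False
    moreover have "\<kappa> * height p \<noteq> 0" using kappa t by simp
    ultimately have "- (\<kappa> * height p) > 0" by linarith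
    then show ?thesis
      using vol[of "?c 2" "?c 1"] d[of 2 1] by (simp add: w smooth_on_coord_field)
  qed
  then have "(\<kappa> * height p)\<^sup>2 = ?d"
    by (metis abs_ge_zero power2_abs real_sqrt_pow2)
  then have "((\<kappa> * height p)\<^sup>2)\<^sup>2 = (hessian_det u p / (height p)\<^sup>2)\<^sup>2"
    by (metis power2_abs)
  then show ?thesis using t by (simp add: field_simps)
qed

lemma pd_hessian:
  assumes p: "p \<in> U"
  shows "pd k (hessian_det u) p = pd k (pd 1 (pd 1 u)) p * pd 2 (pd 2 u) p
    + pd 1 (pd 1 u) p * pd k (pd 2 (pd 2 u)) p - 2 * pd 2 (pd 1 u) p * pd k (pd 2 (pd 1 u)) p"
    and "hessian_det u differentiable (at p)"
proof -
  note D = has_derivative_pd[OF pd2_differentiable[OF p]]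
  have "(hessian_det u has_derivative
     (\<lambda>v. pd 1 (pd 1 u) p * (v $ 1 * pd 1 (pd 2 (pd 2 u)) p + v $ 2 * pd 2 (pd 2 (pd 2 u)) p)
        + (v $ 1 * pd 1 (pd 1 (pd 1 u)) p + v $ 2 * pd 2 (pd 1 (pd 1 u)) p) * pd 2 (pd 2 u) p
        - (pd 2 (pd 1 u) p * (v $ 1 * pd 1 (pd 2 (pd 1 u)) p + v $ 2 * pd 2 (pd 2 (pd 1 u)) p)
        + (v $ 1 * pd 1 (pd 2 (pd 1 u)) p + v $ 2 * pd 2 (pd 2 (pd 1 u)) p) * pd 2 (pd 1 u) p))) (at p)"
    unfolding hessian_det_def[abs_def] power2_eq_square
    by (intro has_derivative_diff has_derivative_mult D)
  note H = this
  show "hessian_det u differentiable (at p)" using H by (auto simp: differentiable_def)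
  from pd_eq[OF H, of k] show "pd k (hessian_det u) p = pd k (pd 1 (pd 1 u)) p * pd 2 (pd 2 u) p
    + pd 1 (pd 1 u) p * pd k (pd 2 (pd 2 u)) p - 2 * pd 2 (pd 1 u) p * pd k (pd 2 (pd 1 u)) p"
    using exhaust_2[of k] by (auto simp: axis_def)
qed

text \<open>Logarithmic derivative of \<open>height_hessian\<close>: with t the height and H the
  Hessian determinant, 8 dt/t = 2 dH/H.\<close>

lemma pd_height_hessian:
  assumes p: "p \<in> U"
  shows "4 * hessian_det u p * (pd k height p / height p) = pd k (hessian_det u) p"
proof -
  note t = height_nonzero[OF p] and H = hessian[OF p]
  have D: "((\<lambda>q. \<kappa>^4 * height q ^ 8) has_derivative
    (\<lambda>v. \<kappa>^4 * (of_nat 8 * (v $ 1 * pd 1 height p + v $ 2 * pd 2 height p) * height p ^ (8 - 1)))) (at p)"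
    by (intro has_derivative_mult_right has_derivative_power has_derivative_pd height_differentiable p)
  have "((\<lambda>q. (hessian_det u q)\<^sup>2) has_derivative
    (\<lambda>v. \<kappa>^4 * (of_nat 8 * (v $ 1 * pd 1 height p + v $ 2 * pd 2 height p) * height p ^ (8 - 1)))) (at p)"
    by (rule has_derivative_transform_within_open[OF D U p]) (rule height_hessian)
  from pd_eq[OF this, of k]
  have 1: "pd k (\<lambda>q. (hessian_det u q)\<^sup>2) p = \<kappa>^4 * (8 * pd k height p * height p ^ 7)"
    using exhaust_2[of k] by (auto simp: axis_def)
  have "((\<lambda>q. (hessian_det u q)\<^sup>2) has_derivative
    (\<lambda>v. of_nat 2 * (v $ 1 * pd 1 (hessian_det u) p + v $ 2 * pd 2 (hessian_det u) p) * hessian_det u p ^ (2 - 1))) (at p)"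
    by (intro has_derivative_power has_derivative_pd pd_hessian p)
  from pd_eq[OF this, of k]
  have 2: "pd k (\<lambda>q. (hessian_det u q)\<^sup>2) p = 2 * pd k (hessian_det u) p * hessian_det u p"
    using exhaust_2[of k] by (auto simp: axis_def)
  \<comment> \<open>Multiplying by the height restores the eighth power, so that
    \<open>height_hessian\<close> can eliminate \<kappa>.\<close>
  have "(\<kappa>^4 * height p ^ 8) * (8 * pd k height p) = 2 * pd k (hessian_det u) p * hessian_det u p * height p"
    using 1 unfolding 2 by (simp add: power_eq_if)
  then have "2 * hessian_det u p * (4 * hessian_det u p * pd k height p)
      = 2 * hessian_det u p * (pd k (hessian_det u) p * height p)"
    unfolding height_hessian[OF p] by (simp add: power2_eq_square)
  moreover have "2 * hessian_det u p \<noteq> 0" using H by simp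
  ultimately have "4 * hessian_det u p * pd k height p = pd k (hessian_det u) p * height p"
    using mult_left_cancel by blast
  then show ?thesis using t by (simp add: field_simps)
qed

text \<open>By \<open>pd_height\<close> the contractions of the Hessian with the horizontal part of
  \<open>A\<close> are negative derivatives of the height; contracting over the other index uses the
  symmetry of the Hessian.\<close>

lemma cubic_form_coord_eq:
  assumes p: "p \<in> U"
  defines "s \<equiv> \<lambda>i. pd i height p / height p"
  shows "cubic_form (graph_param u) A (coord_field k) (coord_field i) (coord_field j) p =
    (pd k (pd i (pd j u)) p - pd i (pd j u) p * s k - pd k (pd i u) p * s j - pd k (pd j u) p * s i) / height p"
proof -
  have "pd 1 (pd j u) p * A p $ 1 + pd 2 (pd j u) p * A p $ 2 = - pd j height p"
    unfolding pd_height[OF p] using pd_commute[OF U p u] by simp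
  moreover have "pd i (pd 1 u) p * A p $ 1 + pd i (pd 2 u) p * A p $ 2 = - pd i height p"
    unfolding pd_height[OF p] by simp
  ultimately show ?thesis
    unfolding cubic_form_coord[OF p] s_def by simp
qed

text \<open>The metric is the Hessian divided by the height t, with determinant H/t^2; hence the
  factor \<open>m\<close> in front of the adjugate.\<close>

lemma matrix_inv_metric:
  assumes p: "p \<in> U"
  defines "m \<equiv> height p / hessian_det u p"
  shows "matrix_inv (metric_matrix (graph_param u) A p) =
    vector [vector [m * pd 2 (pd 2 u) p, - (m * pd 2 (pd 1 u) p)],
            vector [- (m * pd 2 (pd 1 u) p), m * pd 1 (pd 1 u) p]]" (is "matrix_inv ?M = ?N")
proof -
  note t = height_nonzero[OF p] and H = hessian[OF p] and sym = pd_commute[OF U p u, of 1 2]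
  have "?M ** ?N = mat 1" "?N ** ?M = mat 1"
    using t H unfolding m_def
    by (simp_all add: vec_eq_iff forall_2 matrix_matrix_mult_def sum_2 metric_matrix_def
          affine_form_coord[OF p] mat_def sym)
      (simp_all add: divide_simps, simp_all add: hessian_det_def power2_eq_square algebra_simps)
  then show ?thesis by (rule matrix_inv_unique)
qed

text \<open>Three inverse metrics contribute (t/H)^3 and two cubic forms contribute t^(-2); what
  remains is the \<open>cubic_norm\<close> of a trace-free form.\<close>

lemma fubini_pick_eq:
  assumes p: "p \<in> U"
  shows "4 * fubini_pick (graph_param u) A p = height p / hessian_det u p ^ 3 * pick_F u p"
proof -
  define t H where "t = height p" and "H = hessian_det u p"
  have t: "t \<noteq> 0" and H: "H \<noteq> 0"
    using height_nonzero[OF p] hessian[OF p] by (simp_all add: t_def H_def)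
  define s1 s2 where "s1 = pd 1 height p / t" and "s2 = pd 2 height p / t"
  define uxx uxy uyy where "uxx = pd 1 (pd 1 u) p" and "uxy = pd 2 (pd 1 u) p" and "uyy = pd 2 (pd 2 u) p"
  define uxxx uxxy uxyy uyyy where "uxxx = pd 1 (pd 1 (pd 1 u)) p" and "uxxy = pd 2 (pd 1 (pd 1 u)) p"
    and "uxyy = pd 2 (pd 2 (pd 1 u)) p" and "uyyy = pd 2 (pd 2 (pd 2 u)) p"
  note defs = uxx_def uxy_def uyy_def uxxx_def uxxy_def uxyy_def uyyy_def
  have 2: "pd 1 (pd 2 u) p = uxy" using pd_commute[OF U p u] by (simp add: defs)
  \<comment> \<open>Exchanging the inner derivatives uses equality of the functions near
    \<open>p\<close>, not only at \<open>p\<close>.\<close>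
  have inner: "pd k (pd 1 (pd 2 u)) p = pd k (pd 2 (pd 1 u)) p" for k
    by (rule pd_cong[OF pd2_differentiable[OF p] U p]) (rule pd_commute[OF U _ u])
  note outer = pd_commute[OF U p smooth_on_pd[OF u], of 1 2]
  have 3: "pd 1 (pd 2 (pd 1 u)) p = uxxy" "pd 1 (pd 1 (pd 2 u)) p = uxxy"
    "pd 1 (pd 2 (pd 2 u)) p = uxyy" "pd 2 (pd 1 (pd 2 u)) p = uxyy"
    using inner outer by (simp_all add: defs)
  define a b c d where "a = uxxx - 3 * s1 * uxx" and "b = uxxy - 2 * s1 * uxy - s2 * uxx"
    and "c = uxyy - 2 * s2 * uxy - s1 * uyy" and "d = uyyy - 3 * s2 * uyy"
  let ?C = "\<lambda>k i j. cubic_form (graph_param u) A (coord_field k) (coord_field i) (coord_field j) p"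
  have C: "?C 1 1 1 = inverse t * a" "?C 2 1 1 = inverse t * b" "?C 1 2 1 = inverse t * b"
    "?C 1 1 2 = inverse t * b" "?C 1 2 2 = inverse t * c" "?C 2 1 2 = inverse t * c"
    "?C 2 2 1 = inverse t * c" "?C 2 2 2 = inverse t * d"
    unfolding cubic_form_coord_eq[OF p] defs[symmetric] 2 3 a_def b_def c_def d_def s1_def s2_def t_def[symmetric]
    by (simp_all add: field_simps)
  have Heq: "H = uxx * uyy - uxy\<^sup>2" by (simp add: H_def hessian_det_def defs)
  have s: "4 * H * s1 = uxxx * uyy + uxx * uxyy - 2 * uxy * uxxy"
    "4 * H * s2 = uxxy * uyy + uxx * uyyy - 2 * uxy * uxyy"
    unfolding s1_def s2_def t_def H_def pd_height_hessian[OF p] pd_hessian(1)[OF p]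
    by (simp_all add: 3 defs[symmetric])
  \<comment> \<open>The adjugate trace of the third derivative of \<open>u\<close> is dH, with
    components 4 H s_k; the subtracted terms have adjugate trace 2 H s_k + H s_k + H s_k.\<close>
  have apolar: "uyy * a - 2 * uxy * b + uxx * c = 0" "uyy * b - 2 * uxy * c + uxx * d = 0"
    using s unfolding Heq a_def b_def c_def d_def by algebra+
  define m n where "m = t / H" and "n = inverse t"
  let ?N = "cubic_norm uxx uxy uyy a b c d"
  have contraction: "fubini_pick (graph_param u) A p = m^3 * n^2 * ?N"
    unfolding fubini_pick_def cubic_norm_def Let_def sum_2 C matrix_inv_metric[OF p] vector_2
      t_def[symmetric] H_def[symmetric] defs[symmetric] m_def[symmetric] n_def[symmetric]
    by algebra
  \<comment> \<open>Trace-freeness turns \<open>cubic_norm\<close> into \<open>pick_poly\<close>,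
    from which the terms with \<open>s1\<close> and \<open>s2\<close> disappear.\<close>
  have norm: "4 * ?N = pick_F u p"
    unfolding apolar_cubic_norm[OF apolar] pick_F_eq_pick_poly defs[symmetric]
    unfolding a_def b_def c_def d_def by (rule pick_poly_shift)
  have scale: "m^3 * n^2 = t / H^3" using t H by (simp add: m_def n_def field_simps power2_eq_square power3_eq_cube)
  have "4 * fubini_pick (graph_param u) A p = m^3 * n^2 * (4 * ?N)"
    unfolding contraction by (simp only: mult.left_commute)
  then show ?thesis unfolding norm scale t_def H_def .
qed

end

theorem proposition3p2:
  fixes u :: "real^2 \<Rightarrow> real" and U :: "(real^2) set"
    and \<omega> :: "real^3 \<Rightarrow> real^3 \<Rightarrow> real^3 \<Rightarrow> real^3 \<Rightarrow> real"
    and A :: "real^2 \<Rightarrow> real^3"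
  assumes "open U" and "smooth_on U u"
    and "\<And>p. p \<in> U \<Longrightarrow> hessian_det u p \<noteq> 0"
    and "parallel_volume_form \<omega>"
    and "affine_normal \<omega> U (graph_param u) A"
  shows "\<forall>p\<in>U. pick_F u p = 0 \<longleftrightarrow> fubini_pick (graph_param u) A p = 0"
proof
  fix p assume p: "p \<in> U"
  obtain \<kappa> where "\<kappa> \<noteq> 0"
    "\<And>q x y z. \<omega> q x y z = \<kappa> * det (vector [x, y, z] :: real^3^3)"
    using parallel_volume_form_det[OF assms(4)] by blast
  then interpret blaschke_graph U u A \<kappa> \<omega>
    using assms by unfold_locales (auto simp: affine_normal_def)
  \<comment> \<open>The factor \<open>height p / hessian_det u p ^ 3\<close> between the two
    quantities is nonzero.\<close>
  show "pick_F u p = 0 \<longleftrightarrow> fubini_pick (graph_param u) A p = 0"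
    using fubini_pick_eq[OF p] height_nonzero[OF p] assms(3)[OF p] by auto
qed

end
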